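(* Let $B$ be a Blaschke product and, for $0<r<1$, let $$T(r)=T(B)(r)=\frac{1}{\log r}\,\frac{1}{2\pi}\int_{0}^{2\pi}\log|B(re^{i\theta})|\,d\theta .$$ Then $B$ is an exponential Blaschke product if and only if there exists a constant $M=M(B)>0$ such that $|T(1-2^{-N-1})-T(1-2^{-N})|\le M$ for any $N=1,2,\dotsc$.
   Context: Let $\mathbb{D}$ be the open unit disc of the complex plane. A Blaschke product is a (finite or infinite) product $B(z)=\prod_{n}\frac{\overline{z}_{n}}{|z_{n}|}\frac{z_{n}-z}{1-\overline{z}_{n}z}$, $z\in\mathbb{D}$, with zeros $z_n\in\mathbb{D}$ (repeated according to multiplicity) satisfying $\sum_n(1-|z_n|)<\infty$, with the convention $\overline{z}/|z|=1$ if $z=0$. A Blaschke product $B$ is called an exponential Blaschke product if there exists a constant $M=M(B)>0$ such that for any $k=1,2,\dotsc$ one has $\#\{z: B(z)=0,\ 2^{-k-1}\le 1-|z|\le 2^{-k}\}\le M$, where zeros are counted with multiplicity. *)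

theory Defs
  imports "HOL-Complex_Analysis.Complex_Analysis"
begin

definition blaschke_factor :: "complex \<Rightarrow> complex \<Rightarrow> complex" where
  "blaschke_factor a z =
     (if a = 0 then 1 else cnj a / of_real (norm a)) * ((a - z) / (1 - cnj a * z))"

(* Finite products are those with a finite index set I, the empty product B = 1 included.
   Summability makes the infinite product converge absolutely on the disc, so the value of
   prodinf is always the genuine limit there. Nothing is said about B outside the disc. *)
definition is_blaschke_product :: "(complex \<Rightarrow> complex) \<Rightarrow> bool" where
  "is_blaschke_product B \<longleftrightarrow>
     (\<exists>(I :: nat set) (a :: nat \<Rightarrow> complex).
        (\<forall>n\<in>I. norm (a n) < 1) \<and>
        (\<lambda>n. 1 - norm (a n)) summable_on I \<and>
        (\<forall>z. norm z < 1 \<longrightarrow> B z = (\<Prod>n. if n \<in> I then blaschke_factor (a n) z else 1)))"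

(* The bounds put the zeros in a compact annulus inside the disc, so for a Blaschke product
   this is a finite sum of positive orders. *)
definition dyadic_zero_count :: "(complex \<Rightarrow> complex) \<Rightarrow> nat \<Rightarrow> int" where
  "dyadic_zero_count B k =
     (\<Sum>z | B z = 0 \<and> (1/2) ^ (k + 1) \<le> 1 - norm z \<and> 1 - norm z \<le> (1/2) ^ k. zorder B z)"

definition exponential_blaschke_product :: "(complex \<Rightarrow> complex) \<Rightarrow> bool" where
  "exponential_blaschke_product B \<longleftrightarrow>
     is_blaschke_product B \<and>
     (\<exists>M::real. M > 0 \<and> (\<forall>k\<ge>1. of_int (dyadic_zero_count B k) \<le> M))"

(* A Blaschke product has only finitely many zeros on the circle of radius r < 1, so the
   convention ln 0 = 0 does not affect the integral. *)
definition blaschke_T :: "(complex \<Rightarrow> complex) \<Rightarrow> real \<Rightarrow> real" where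
  "blaschke_T B r =
     1 / ln r * (1 / (2 * pi)) * (LBINT \<theta>:{0..2*pi}. ln (norm (B (of_real r * cis \<theta>))))"

end

theory Submission
  imports Defs
begin

text \<open>
  The mean of \<open>ln \<bar>a - z\<bar>\<close> over the circle of radius \<open>r\<close> is \<open>ln (max \<bar>a\<bar> r)\<close>, and the mean of
  \<open>ln \<bar>1 - cnj a * z\<bar>\<close> vanishes. Summing over the zeros \<open>a\<^sub>n\<close> gives Jensen's formula
  \<open>T r = (\<Sum>n. ln (max \<bar>a\<^sub>n\<bar> r) / ln r)\<close>, a sum of weights in \<open>[0, 1]\<close> that are increasing in \<open>r\<close>.
  From \<open>1 - 2 x\<close> to \<open>1 - x\<close>, where \<open>x = 2 ^ -(N + 1)\<close>, the weight of a zero at distance between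
  \<open>x / 2\<close> and \<open>x\<close> from the unit circle grows by at least \<open>1 / 8\<close>, so the increment of \<open>T\<close> bounds the
  number of zeros at level \<open>N + 1\<close>. Conversely, zeros of modulus at most \<open>1 - 2 x\<close> do not contribute to
  this increment and a zero at level \<open>k \<ge> N\<close> contributes at most \<open>4 * 2 ^ (N - k)\<close>, which is
  summable over the levels.
\<close>

subsection \<open>Circle means of logarithms\<close>

text \<open>Integrability is built in: the Lebesgue integral of a non-integrable function defaults
  to 0, and means would then fail to be additive.\<close>

definition has_circle_mean :: "(complex \<Rightarrow> real) \<Rightarrow> real \<Rightarrow> real \<Rightarrow> bool" where
  "has_circle_mean f r m \<longleftrightarrow>
     has_bochner_integral lborel (\<lambda>t. indicator {0..2*pi} t *\<^sub>R f (of_real r * cis t)) (2 * pi * m)"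

lemma has_circle_mean_imp_LBINT:
  assumes "has_circle_mean f r m"
  shows "(LBINT t:{0..2*pi}. f (of_real r * cis t)) = 2 * pi * m"
  using assms by (simp add: has_circle_mean_def set_lebesgue_integral_def has_bochner_integral_iff)

lemma has_circle_mean_add:
  "has_circle_mean f r m \<Longrightarrow> has_circle_mean g r m' \<Longrightarrow> has_circle_mean (\<lambda>z. f z + g z) r (m + m')"
  unfolding has_circle_mean_def
  by (drule (1) has_bochner_integral_add) (simp add: algebra_simps)

lemma has_circle_mean_diff:
  "has_circle_mean f r m \<Longrightarrow> has_circle_mean g r m' \<Longrightarrow> has_circle_mean (\<lambda>z. f z - g z) r (m - m')"
  unfolding has_circle_mean_def
  by (drule (1) has_bochner_integral_diff) (simp add: algebra_simps)

lemma has_circle_mean_sum: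
  "(\<And>i. i \<in> I \<Longrightarrow> has_circle_mean (f i) r (m i)) \<Longrightarrow>
     has_circle_mean (\<lambda>z. \<Sum>i\<in>I. f i z) r (\<Sum>i\<in>I. m i)"
  unfolding has_circle_mean_def
  by (drule has_bochner_integral_sum) (simp add: sum_distrib_left)

lemma has_circle_mean_const: "has_circle_mean (\<lambda>_. c) r c"
proof -
  have "has_bochner_integral lborel (\<lambda>t. indicator {0..2*pi} t *\<^sub>R c) (measure lborel {0..2*pi} *\<^sub>R c)"
    by (intro has_bochner_integral_scaleR_left has_bochner_integral_real_indicator) auto
  thus ?thesis by (simp add: has_circle_mean_def)
qed

lemma countable_circle_angles:
  assumes "r \<noteq> 0"
  shows "countable {t. of_real r * cis t = a}"
proof (cases "\<exists>t0. of_real r * cis t0 = a")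
  case True
  then obtain t0 where t0: "of_real r * cis t0 = a" by blast
  have "{t. of_real r * cis t = a} \<subseteq> range (\<lambda>n::int. t0 + 2 * pi * n)"
  proof
    fix t assume "t \<in> {t. of_real r * cis t = a}"
    hence "cis t = cis t0" using t0 assms by auto
    hence "sin t = sin t0 \<and> cos t = cos t0" by (simp add: complex_eq_iff)
    thus "t \<in> range (\<lambda>n::int. t0 + 2 * pi * n)" by (auto simp: sin_cos_eq_iff)
  qed
  thus ?thesis by (rule countable_subset) auto
qed auto

text \<open>Only countably many angles lead into a countable \<open>A\<close>, and they form a null
  set. The exceptional set absorbs zeros, where the laws of the logarithm break down under
  \<open>ln 0 = 0\<close>.\<close>

lemma has_circle_mean_cong:
  assumes "has_circle_mean f r m" and "countable A" and "r > 0"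
    and "\<And>z. norm z = r \<Longrightarrow> z \<notin> A \<Longrightarrow> f z = g z"
  shows "has_circle_mean g r m"
proof -
  define X where "X = (\<Union>a\<in>A. {t. of_real r * cis t = a})"
  have "countable X"
    unfolding X_def using assms(2,3) by (intro countable_UN countable_circle_angles) auto
  have "has_bochner_integral lborel (\<lambda>t. indicator {0..2*pi} t *\<^sub>R f (of_real r * cis t)) (2*pi*m) \<longleftrightarrow>
        has_bochner_integral lborel (\<lambda>t. indicator {0..2*pi} t *\<^sub>R g (of_real r * cis t)) (2*pi*m)"
    by (rule has_bochner_integral_discrete_difference[where X = X])
       (use \<open>countable X\<close> assms(3,4) in \<open>auto simp: X_def norm_mult\<close>)
  with assms(1) show ?thesis by (simp add: has_circle_mean_def)
qed

text \<open>Mean value property of a harmonic function: a zero-free \<open>H\<close> on a disc has a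
  holomorphic logarithm \<open>g\<close>, and \<open>ln (norm (H z))\<close> is its real
  part.\<close>

lemma has_circle_mean_ln_norm_holomorphic:
  assumes holo: "H holomorphic_on ball 0 R" and nz: "\<And>z. norm z < R \<Longrightarrow> H z \<noteq> 0"
    and r: "0 < r" "r < R"
  shows "has_circle_mean (\<lambda>z. ln (norm (H z))) r (ln (norm (H 0)))"
proof -
  obtain g where g: "g holomorphic_on ball 0 R" "\<And>z. z \<in> ball 0 R \<Longrightarrow> exp (g z) = H z"
    using holomorphic_logarithm_exists[of "ball 0 R" H 0] holo nz r by auto
  have ln_eq: "ln (norm (H z)) = Re (g z)" if "norm z < R" for z
    using g(2)[of z] that by (metis dist_0_norm exp_ln ln_exp mem_ball norm_exp_eq_Re)
  \<comment> \<open>Cauchy's formula at the centre: the derivative of the parametrisation cancels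
    the denominator up to the factor \<open>\<i>\<close>, and the imaginary part of
    \<open>\<i> * g\<close> is \<open>Re g\<close>.\<close>
  have "((\<lambda>u. g u / (u - 0)) has_contour_integral (2 * of_real pi * \<i> * g 0)) (circlepath 0 r)"
    by (rule Cauchy_integral_circlepath_simple)
       (use r in \<open>auto intro!: holomorphic_on_subset[OF g(1)]\<close>)
  hence "((\<lambda>t. g (0 + of_real r * cis t) / (0 + of_real r * cis t - 0) * of_real r * \<i> * cis t) has_integral
          (2 * of_real pi * \<i> * g 0)) {0..2*pi}"
    unfolding circlepath_def by (subst (asm) has_contour_integral_part_circlepath_iff) auto
  hence "((\<lambda>t. \<i> * g (of_real r * cis t)) has_integral (2 * of_real pi * \<i> * g 0)) {0..2*pi}"
    using r by (simp add: mult_ac)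
  hence "((\<lambda>t. Im (\<i> * g (of_real r * cis t))) has_integral Im (2 * of_real pi * \<i> * g 0)) {0..2*pi}"
    by (rule has_integral_Im)
  hence int: "((\<lambda>t. Re (g (of_real r * cis t))) has_integral (2 * pi * Re (g 0))) {0..2*pi}"
    by simp
  \<comment> \<open>Continuity allows the gauge integral to be read as a Lebesgue integral.\<close>
  have "continuous_on {0..2*pi} (\<lambda>t. Re (g (of_real r * cis t)))"
    by (intro continuous_intros continuous_on_compose2[OF holomorphic_on_imp_continuous_on[OF g(1)]])
       (use r in \<open>auto simp: norm_mult\<close>)
  hence si: "set_integrable lborel {0..2*pi} (\<lambda>t. Re (g (of_real r * cis t)))"
    by (rule borel_integrable_atLeastAtMost')
  hence "(LBINT t:{0..2*pi}. Re (g (of_real r * cis t))) = 2 * pi * Re (g 0)"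
    using set_borel_integral_eq_integral(2) int by (metis integral_unique)
  with si have "has_circle_mean (\<lambda>z. Re (g z)) r (Re (g 0))"
    by (simp add: has_circle_mean_def has_bochner_integral_iff set_integrable_def set_lebesgue_integral_def)
  hence "has_circle_mean (\<lambda>z. ln (norm (H z))) r (Re (g 0))"
    by (rule has_circle_mean_cong[where A = "{}"]) (use r ln_eq in auto)
  thus ?thesis using ln_eq[of 0] r by simp
qed

section \<open>Mean of \<open>ln (norm (a - z))\<close> for \<open>a\<close> outside, inside and on
  the circle\<close>

lemma has_circle_mean_ln_dist_outside:
  assumes "0 < r" "r < norm a"
  shows "has_circle_mean (\<lambda>z. ln (norm (a - z))) r (ln (norm a))"
proof -
  have "has_circle_mean (\<lambda>z. ln (norm (a - z))) r (ln (norm (a - 0)))"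
    by (rule has_circle_mean_ln_norm_holomorphic[where R = "norm a"])
       (use assms in \<open>auto intro!: holomorphic_intros\<close>)
  thus ?thesis by simp
qed

text \<open>
  On the circle, \<open>\<bar>a - z\<bar>\<close> agrees with \<open>\<bar>r - cnj a * z / r\<bar>\<close>, whose zero is the reflection of \<open>a\<close> and
  lies outside.
\<close>
lemma has_circle_mean_ln_dist_inside:
  assumes "norm a < r"
  shows "has_circle_mean (\<lambda>z. ln (norm (a - z))) r (ln r)"
proof -
  have r: "r > 0" using assms norm_ge_zero[of a] by linarith
  \<comment> \<open>This radius lies strictly between \<open>r\<close> and the modulus
    \<open>r * r / norm a\<close> of the reflected point, and its formula also makes sense for
    \<open>a = 0\<close>.\<close>
  define R where "R = r * (2 * r / (norm a + r))"
  have "2 * r / (norm a + r) > 1"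
    using assms r by (auto simp: field_simps add_pos_nonneg add_nonneg_pos)
  from mult_strict_left_mono[OF this r] have R: "r < R" by (simp add: R_def)
  have nz: "of_real r - cnj a * z / of_real r \<noteq> 0" if "norm z < R" for z
  proof
    assume "of_real r - cnj a * z / of_real r = 0"
    hence "norm (cnj a * z / of_real r) = norm (of_real r :: complex)" by simp
    hence *: "norm a * norm z = r * r" using r by (simp add: norm_mult norm_divide field_simps)
    have "norm a * norm z \<le> norm a * R" using that by (intro mult_left_mono) auto
    also have "\<dots> < r * r"
    proof -
      have "norm a * (2 * r) < r * (norm a + r)"
        using assms r by (simp add: algebra_simps)
      hence "norm a * (2 * r / (norm a + r)) < r"
        using pos_divide_less_eq[of "norm a + r" "norm a * (2 * r)" r] r by (simp add: add_nonneg_pos)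
      from mult_strict_left_mono[OF this r] show ?thesis by (simp add: R_def mult_ac)
    qed
    finally show False using * by simp
  qed
  have "has_circle_mean (\<lambda>z. ln (norm (of_real r - cnj a * z / of_real r))) r
          (ln (norm (of_real r - cnj a * 0 / of_real r)))"
    by (rule has_circle_mean_ln_norm_holomorphic[where R = R])
       (use r R nz in \<open>auto intro!: holomorphic_intros\<close>)
  moreover have "norm (of_real r - cnj a * z / of_real r) = norm (a - z)" if "norm z = r" for z
  proof -
    have "z * cnj z = of_real (r\<^sup>2)" using that by (simp add: complex_norm_square[symmetric])
    hence "of_real r - cnj a * z / of_real r = (z / of_real r) * cnj (z - a)"
      using r by (simp add: field_simps power2_eq_square)
    thus ?thesis using that r by (simp add: norm_mult norm_divide norm_minus_commute del: complex_cnj_diff)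
  qed
  ultimately show ?thesis
    using r by (auto elim!: has_circle_mean_cong[where A = "{}"])
qed

text \<open>
  The singular circle is a limit of the regular circles of radius \<open>s * r\<close>, \<open>s < 1\<close>: Fatou's lemma gives
  integrability, and \<open>\<bar>a - z\<bar> \<le> 2 * \<bar>a - s * z\<bar>\<close> then allows dominated convergence.
\<close>
lemma has_circle_mean_ln_dist_on:
  assumes "norm a = r" "r > 0"
  shows "has_circle_mean (\<lambda>z. ln (norm (a - z))) r (ln r)"
proof -
  \<comment> \<open>The double successor keeps \<open>s 0 = 1/2\<close> positive.\<close>
  define s :: "nat \<Rightarrow> real" where "s n = 1 - inverse (real (Suc (Suc n)))" for n
  have s: "0 < s n" "s n < 1" for n
    by (auto simp: s_def field_simps)
  have s_lim: "s \<longlonglongrightarrow> 1"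
    using tendsto_diff[OF tendsto_const[of 1] LIMSEQ_Suc[OF LIMSEQ_inverse_real_of_nat]]
    by (simp add: s_def[abs_def])
  \<comment> \<open>\<open>ln (2 * r)\<close> bounds all the logarithms, so \<open>h n\<close> is
    nonnegative, as Fatou's lemma requires. The absolute value also covers the singular point
    \<open>a = z t\<close>, where \<open>ln 0 = 0\<close>.\<close>
  define K where "K = \<bar>ln (2 * r)\<bar>"
  define z where "z t = of_real r * cis t" for t
  have nz: "norm (z t) = r" for t using assms by (simp add: z_def norm_mult)
  define h where "h n t = indicator {0..2*pi} t *\<^sub>R (K - ln (norm (a - of_real (s n) * z t)))" for n t
  define h0 where "h0 t = indicator {0..2*pi} t *\<^sub>R (K - ln (norm (a - z t)))" for t
  define I where "I = 2 * pi * (K - ln r)"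

  have lower: "norm (a - of_real (s n) * z t) > 0" for n t
  proof -
    have "norm a - norm (of_real (s n) * z t) \<le> norm (a - of_real (s n) * z t)"
      by (rule norm_triangle_ineq2)
    moreover have "norm (of_real (s n) * z t) = s n * r"
      using s[of n] by (simp add: norm_mult nz)
    moreover have "s n * r < r" using s[of n] assms by simp
    ultimately show ?thesis using assms by linarith
  qed
  have upper: "norm (a - of_real (s n) * z t) \<le> 2 * r" for n t
  proof -
    have "norm (a - of_real (s n) * z t) \<le> norm a + norm (of_real (s n) * z t)"
      by (rule norm_triangle_ineq4)
    also have "norm (of_real (s n) * z t) \<le> r"
      using s[of n] assms by (simp add: norm_mult nz)
    finally show ?thesis using assms by simp
  qed
  have half: "norm (a - z t) \<le> 2 * norm (a - of_real (s n) * z t)" for n t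
  proof -
    have "norm (a - z t) = norm ((a - of_real (s n) * z t) - of_real (1 - s n) * z t)"
      by (simp add: algebra_simps)
    also have "\<dots> \<le> norm (a - of_real (s n) * z t) + norm (of_real (1 - s n) * z t)"
      by (rule norm_triangle_ineq4)
    \<comment> \<open>The point \<open>s n * z t\<close> lies on the radius to \<open>z t\<close>,
      so its distance to \<open>z t\<close> is its distance to the circle, hence at most its
      distance to \<open>a\<close>.\<close>
    also have "norm (of_real (1 - s n) * z t) = norm a - norm (of_real (s n) * z t)"
    proof -
      have "norm (of_real (1 - s n) :: complex) = 1 - s n" using s[of n] by (simp only: norm_of_real)
      hence "norm (of_real (1 - s n) * z t) = (1 - s n) * r" by (simp only: norm_mult nz)
      thus ?thesis using s[of n] assms by (simp add: norm_mult nz algebra_simps)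
    qed
    also have "\<dots> \<le> norm (a - of_real (s n) * z t)"
      by (rule norm_triangle_ineq2)
    finally show ?thesis by simp
  qed

  have h_int: "has_bochner_integral lborel (h n) I" for n
  proof -
    have "has_circle_mean (\<lambda>w. ln (norm (a - w))) (s n * r) (ln (norm a))"
      by (rule has_circle_mean_ln_dist_outside) (use s[of n] assms in auto)
    hence "has_circle_mean (\<lambda>w. K - ln (norm (a - w))) (s n * r) (K - ln r)"
      unfolding assms(1) by (intro has_circle_mean_diff has_circle_mean_const)
    thus ?thesis
      by (simp add: has_circle_mean_def h_def[abs_def] I_def z_def mult_ac)
  qed
  have h_nonneg: "h n t \<ge> 0" for n t
  proof -
    have "ln (norm (a - of_real (s n) * z t)) \<le> ln (2 * r)"
      using lower upper by (subst ln_le_cancel_iff) (use assms in auto)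
    also have "\<dots> \<le> K" by (simp add: K_def)
    finally show ?thesis by (simp add: h_def)
  qed
  have h0_nonneg: "h0 t \<ge> 0" for t
  proof (cases "a = z t")
    case False
    have "norm (a - z t) \<le> 2 * r"
      using norm_triangle_ineq4[of a "z t"] nz[of t] assms by simp
    hence "ln (norm (a - z t)) \<le> ln (2 * r)"
      using False by (subst ln_le_cancel_iff) (use assms in auto)
    also have "\<dots> \<le> K" by (simp add: K_def)
    finally show ?thesis by (simp add: h0_def)
  qed (auto simp: h0_def K_def)
  have "countable {t. z t = a}"
    unfolding z_def using assms by (intro countable_circle_angles) auto
  hence "AE t in lborel. t \<notin> {t. z t = a}"
    by (rule AE_discrete_difference) auto
  hence AE_ne: "AE t in lborel. a \<noteq> z t"
    by eventually_elim auto
  have AE_lim: "AE t in lborel. (\<lambda>n. h n t) \<longlonglongrightarrow> h0 t"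
    using AE_ne
  proof eventually_elim
    case (elim t)
    have "(\<lambda>n. a - of_real (s n) * z t) \<longlonglongrightarrow> a - of_real 1 * z t"
      by (intro tendsto_intros s_lim)
    hence "(\<lambda>n. ln (norm (a - of_real (s n) * z t))) \<longlonglongrightarrow> ln (norm (a - z t))"
      using elim by (intro tendsto_ln tendsto_norm) auto
    thus ?case
      unfolding h_def h0_def by (rule tendsto_scaleR[OF tendsto_const tendsto_diff[OF tendsto_const]])
  qed
  have [measurable]: "h n \<in> borel_measurable lborel" for n
    using h_int[of n] by (auto simp: has_bochner_integral_iff)
  have "z \<in> borel_measurable borel"
    unfolding z_def[abs_def] by (intro borel_measurable_continuous_onI continuous_intros)
  hence [measurable]: "z \<in> borel_measurable lborel" by simp
  have [measurable]: "h0 \<in> borel_measurable lborel"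
    unfolding h0_def[abs_def] by measurable
  have h0_int: "integrable lborel h0"
  proof (rule integrableI_nonneg)
    have "(\<integral>\<^sup>+t. ennreal (h0 t) \<partial>lborel) = (\<integral>\<^sup>+t. liminf (\<lambda>n. ennreal (h n t)) \<partial>lborel)"
    proof (rule nn_integral_cong_AE)
      show "AE t in lborel. ennreal (h0 t) = liminf (\<lambda>n. ennreal (h n t))"
        using AE_lim by eventually_elim (intro lim_imp_Liminf[symmetric] tendsto_ennrealI; simp)
    qed
    also have "\<dots> \<le> liminf (\<lambda>n. \<integral>\<^sup>+t. ennreal (h n t) \<partial>lborel)"
      by (intro nn_integral_liminf) auto
    also have "(\<lambda>n. \<integral>\<^sup>+t. ennreal (h n t) \<partial>lborel) = (\<lambda>n. ennreal I)"
      using h_int h_nonneg by (intro ext) (simp add: nn_integral_eq_integral has_bochner_integral_iff)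
    also have "liminf (\<lambda>n::nat. ennreal I) = ennreal I"
      by (intro Liminf_const) auto
    finally show "(\<integral>\<^sup>+t. ennreal (h0 t) \<partial>lborel) < \<infinity>"
      using ennreal_less_top[of I] by (auto simp: le_less_trans)
  qed (use h0_nonneg in auto)
  have "(\<lambda>n. integral\<^sup>L lborel (h n)) \<longlonglongrightarrow> integral\<^sup>L lborel h0"
  proof (rule integral_dominated_convergence)
    \<comment> \<open>By \<open>half\<close>, passing from \<open>z t\<close> to
      \<open>s n * z t\<close> lowers the logarithm by at most \<open>ln 2\<close>.\<close>
    show "integrable lborel (\<lambda>t. h0 t + ln 2 * indicator {0..2*pi} t)"
      by (intro Bochner_Integration.integrable_add h0_int integrable_mult_right integrable_real_indicator) auto
    show "AE t in lborel. norm (h n t) \<le> h0 t + ln 2 * indicator {0..2*pi} t" for n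
      using AE_ne
    proof eventually_elim
      case (elim t)
      have "ln (norm (a - z t)) \<le> ln (2 * norm (a - of_real (s n) * z t))"
        using half[of t n] lower[of n t] elim by (subst ln_le_cancel_iff) auto
      also have "\<dots> = ln 2 + ln (norm (a - of_real (s n) * z t))"
        using lower[of n t] by (simp add: ln_mult)
      finally show ?case
        using h_nonneg[of n t] by (simp add: h_def h0_def indicator_def)
    qed
  qed (use AE_lim in auto)
  moreover have "integral\<^sup>L lborel (h n) = I" for n
    using h_int by (simp add: has_bochner_integral_iff)
  ultimately have "integral\<^sup>L lborel h0 = I"
    by (simp add: LIMSEQ_const_iff)
  with h0_int have "has_circle_mean (\<lambda>w. K - ln (norm (a - w))) r (K - ln r)"
    by (simp add: has_circle_mean_def has_bochner_integral_iff h0_def[abs_def] I_def z_def)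
  from has_circle_mean_diff[OF has_circle_mean_const[of K] this] show ?thesis
    by simp
qed

lemma has_circle_mean_ln_dist:
  assumes "r > 0"
  shows "has_circle_mean (\<lambda>z. ln (norm (a - z))) r (ln (max (norm a) r))"
  using assms has_circle_mean_ln_dist_inside[of a r] has_circle_mean_ln_dist_outside[of r a]
    has_circle_mean_ln_dist_on[of a r]
  by (cases "norm a" r rule: linorder_cases) (auto simp: max_def)

subsection \<open>Blaschke factors\<close>

lemma one_minus_cnj_mult_nonzero:
  assumes "norm a < 1" "norm z \<le> 1"
  shows "1 - cnj a * z \<noteq> 0"
proof
  assume "1 - cnj a * z = 0"
  hence "norm (cnj a * z) = 1" by simp
  moreover have "norm a * norm z \<le> norm a * 1"
    using assms by (intro mult_left_mono) auto
  ultimately show False using assms by (simp add: norm_mult)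
qed

lemma blaschke_factor_eq_0_iff:
  assumes "norm a < 1" "norm z < 1"
  shows "blaschke_factor a z = 0 \<longleftrightarrow> z = a"
  using one_minus_cnj_mult_nonzero[of a z] assms by (auto simp: blaschke_factor_def)

lemma norm_blaschke_factor:
  "norm (blaschke_factor a z) = norm (a - z) / norm (1 - cnj a * z)"
  by (simp add: blaschke_factor_def norm_mult norm_divide)

lemma blaschke_factor_analytic:
  assumes "norm a < 1" "A \<subseteq> ball 0 1"
  shows "blaschke_factor a analytic_on A"
  unfolding blaschke_factor_def[abs_def]
  by (intro analytic_intros)
     (use one_minus_cnj_mult_nonzero[of a] assms in \<open>fastforce split: if_splits\<close>)+

lemma blaschke_factor_holomorphic:
  assumes "norm a < 1"
  shows "blaschke_factor a holomorphic_on ball 0 1"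
  by (intro analytic_imp_holomorphic blaschke_factor_analytic assms order_refl)

lemma zorder_blaschke_factor:
  assumes "norm a < 1"
  shows "zorder (blaschke_factor a) a = 1"
proof (rule zorder_eqI)
  let ?g = "\<lambda>z. - (if a = 0 then 1 else cnj a / of_real (norm a)) / (1 - cnj a * z)"
  show "?g holomorphic_on ball 0 1"
    by (intro holomorphic_intros) (use one_minus_cnj_mult_nonzero[of a] assms in auto)
  show "?g a \<noteq> 0"
    using one_minus_cnj_mult_nonzero[of a a] assms by auto
  show "blaschke_factor a w = ?g w * (w - a) powi 1" for w
    by (simp add: blaschke_factor_def divide_simps) (simp add: algebra_simps)
qed (use assms in auto)

text \<open>With the unimodular \<open>u = cnj a / norm a\<close> one has
  \<open>u * a = norm a\<close> and \<open>cnj a = norm a * u\<close>, so the numerator of the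
  difference factors as \<open>- (1 - norm a) * (1 + u * z)\<close>. Being linear in
  \<open>1 - norm a\<close>, the bound yields convergence of the product.\<close>

lemma norm_blaschke_factor_minus_1_le:
  assumes "norm a < 1" "norm z \<le> R" "R < 1"
  shows "norm (blaschke_factor a z - 1) \<le> 2 / (1 - R) * (1 - norm a)"
proof -
  have "0 \<le> R" using assms(2) norm_ge_zero order_trans by blast
  have nz: "1 - cnj a * z \<noteq> 0"
    using one_minus_cnj_mult_nonzero[of a z] assms by simp
  have den: "1 - R \<le> norm (1 - cnj a * z)"
  proof -
    have "norm a * norm z \<le> 1 * R" using assms by (intro mult_mono) auto
    moreover have "norm (1::complex) - norm (cnj a * z) \<le> norm (1 - cnj a * z)"
      by (rule norm_triangle_ineq2)
    ultimately show ?thesis by (simp add: norm_mult)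
  qed
  \<comment> \<open>For \<open>a = 0\<close> the value 1 keeps \<open>u\<close> unimodular, and both
    identities for \<open>u\<close> read \<open>0 = 0\<close>.\<close>
  define u where "u = (if a = 0 then 1 else cnj a / of_real (norm a))"
  have norm_u: "norm u = 1" by (simp add: u_def norm_divide)
  have ua: "u * a = of_real (norm a)"
    using complex_norm_square[of a]
    by (auto simp: u_def power2_eq_square field_simps)
  have cu: "cnj a = of_real (norm a) * u"
    by (auto simp: u_def)
  have "blaschke_factor a z - 1 = (u * a - u * z - 1 + cnj a * z) / (1 - cnj a * z)"
    using nz by (simp add: blaschke_factor_def u_def[symmetric] field_simps)
  also have "u * a - u * z - 1 + cnj a * z = - (of_real (1 - norm a) * (1 + u * z))"
    unfolding ua by (simp add: cu algebra_simps)
  also have "norm (- (of_real (1 - norm a) * (1 + u * z)) / (1 - cnj a * z)) =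
               (1 - norm a) * norm (1 + u * z) / norm (1 - cnj a * z)"
    using assms by (simp add: norm_mult norm_divide del: of_real_diff)
  also have "\<dots> \<le> (1 - norm a) * 2 / (1 - R)"
  proof (intro frac_le mult_left_mono den)
    have "norm (1 + u * z) \<le> norm (1::complex) + norm (u * z)" by (rule norm_triangle_ineq)
    thus "norm (1 + u * z) \<le> 2" using assms norm_u by (simp add: norm_mult)
  qed (use assms in auto)
  finally show ?thesis by (simp add: mult_ac)
qed

text \<open>The denominator \<open>1 - cnj a * z\<close> is zero-free on the unit disc and equals 1
  at the origin, so its logarithm has mean 0. The logarithm of the quotient splits except at
  \<open>z = a\<close>.\<close>

lemma has_circle_mean_ln_blaschke_factor:
  assumes "norm a < 1" "0 < r" "r < 1"
  shows "has_circle_mean (\<lambda>z. ln (norm (blaschke_factor a z))) r (ln (max (norm a) r))"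
proof -
  have "has_circle_mean (\<lambda>z. ln (norm (1 - cnj a * z))) r (ln (norm (1 - cnj a * 0)))"
    by (rule has_circle_mean_ln_norm_holomorphic[where R = 1])
       (use assms one_minus_cnj_mult_nonzero[of a] in \<open>auto intro!: holomorphic_intros\<close>)
  hence "has_circle_mean (\<lambda>z. ln (norm (a - z)) - ln (norm (1 - cnj a * z))) r (ln (max (norm a) r) - 0)"
    using has_circle_mean_ln_dist[of r a] assms by (intro has_circle_mean_diff) auto
  hence "has_circle_mean (\<lambda>z. ln (norm (blaschke_factor a z))) r (ln (max (norm a) r) - 0)"
  proof (rule has_circle_mean_cong[where A = "{a}"])
    fix z :: complex assume "norm z = r" "z \<notin> {a}"
    thus "ln (norm (a - z)) - ln (norm (1 - cnj a * z)) = ln (norm (blaschke_factor a z))"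
      using one_minus_cnj_mult_nonzero[of a z] assms
      by (simp add: norm_blaschke_factor ln_div)
  qed (use assms in auto)
  thus ?thesis by simp
qed

subsection \<open>Blaschke products of a zero sequence\<close>

locale blaschke_sequence =
  fixes I :: "nat set" and a :: "nat \<Rightarrow> complex"
  assumes norm_less_1: "n \<in> I \<Longrightarrow> norm (a n) < 1"
    and summable: "(\<lambda>n. 1 - norm (a n)) summable_on I"
begin

definition factor :: "nat \<Rightarrow> complex \<Rightarrow> complex" where
  "factor n z = (if n \<in> I then blaschke_factor (a n) z else 1)"

definition P :: "complex \<Rightarrow> complex" where
  "P z = (\<Prod>n. factor n z)"

text \<open>Turns unordered summability over \<open>I\<close> into an ordinary series over the
  naturals, as the comparison test and the M-test expect.\<close>

lemma summable_deficit: "summable (\<lambda>n. if n \<in> I then 1 - norm (a n) else 0)"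
proof -
  have "(\<lambda>n. if n \<in> I then 1 - norm (a n) else 0) summable_on UNIV \<longleftrightarrow> (\<lambda>n. 1 - norm (a n)) summable_on I"
    by (rule summable_on_cong_neutral) auto
  with summable show ?thesis by (intro summable_on_imp_summable) simp
qed

text \<open>The terms of a convergent series tend to 0, so the deficits are eventually below
  \<open>1 - R\<close>. All finiteness of multiplicities and levels comes from here.\<close>

lemma finite_norm_le:
  assumes "R < 1"
  shows "finite {n\<in>I. norm (a n) \<le> R}"
proof -
  have "eventually (\<lambda>n. (if n \<in> I then 1 - norm (a n) else 0) < 1 - R) sequentially"
    using summable_LIMSEQ_zero[OF summable_deficit] assms by (intro order_tendstoD) auto
  hence "eventually (\<lambda>n. n \<notin> {n\<in>I. norm (a n) \<le> R}) cofinite"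
    unfolding cofinite_eq_sequentially by eventually_elim auto
  thus ?thesis by (simp add: eventually_cofinite)
qed

lemma norm_factor_minus_1_le:
  assumes "norm z \<le> R" "R < 1"
  shows "norm (factor n z - 1) \<le> 2 / (1 - R) * (if n \<in> I then 1 - norm (a n) else 0)"
  using norm_blaschke_factor_minus_1_le[of "a n" z R] norm_less_1[of n] assms
  by (auto simp: factor_def)

lemma has_prod_factor:
  assumes "norm z < 1"
  shows "(\<lambda>n. factor n z) has_prod P z"
proof -
  have "summable (\<lambda>n. norm (factor n z - 1))"
  proof (rule summable_comparison_test')
    show "summable (\<lambda>n. 2 / (1 - norm z) * (if n \<in> I then 1 - norm (a n) else 0))"
      by (intro summable_mult summable_deficit)
    show "norm (norm (factor n z - 1)) \<le> 2 / (1 - norm z) * (if n \<in> I then 1 - norm (a n) else 0)" for n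
      using norm_factor_minus_1_le[of z "norm z" n] assms by simp
  qed
  hence "convergent_prod (\<lambda>n. factor n z)"
    by (intro abs_convergent_prod_imp_convergent_prod summable_imp_abs_convergent_prod)
  thus ?thesis unfolding P_def by (rule convergent_prod_has_prod)
qed

lemma factor_holomorphic: "factor n holomorphic_on ball 0 1"
  using blaschke_factor_holomorphic[of "a n"] norm_less_1[of n]
  by (cases "n \<in> I") (auto simp: factor_def[abs_def])

text \<open>Weierstrass M-test for the sum of \<open>norm (factor n z - 1)\<close> with majorant
  \<open>2 / (1 - R)\<close> times the deficits; the uniform limit of the products agrees with
  \<open>P\<close> pointwise.\<close>

lemma uniform_limit_partial_products:
  assumes "R < 1"
  shows "uniform_limit (cball 0 R) (\<lambda>N z. \<Prod>n<N. factor n z) P sequentially"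
proof -
  have "uniformly_convergent_on (cball 0 R) (\<lambda>N z. \<Prod>n<N. factor n z)"
  proof (rule uniformly_convergent_on_prod')
    show "continuous_on (cball 0 R) (factor n)" for n
      by (rule continuous_on_subset[OF holomorphic_on_imp_continuous_on[OF factor_holomorphic]])
         (use assms in auto)
    show "uniformly_convergent_on (cball 0 R) (\<lambda>N z. \<Sum>n<N. norm (factor n z - 1))"
    proof (rule Weierstrass_m_test')
      show "norm (norm (factor n z - 1)) \<le> 2 / (1 - R) * (if n \<in> I then 1 - norm (a n) else 0)"
        if "z \<in> cball 0 R" for n z
        using norm_factor_minus_1_le[of z R n] that assms by simp
    qed (intro summable_mult summable_deficit)
  qed auto
  then obtain g where g: "uniform_limit (cball 0 R) (\<lambda>N z. \<Prod>n<N. factor n z) g sequentially"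
    by (auto simp: uniformly_convergent_on_def)
  also have "?this \<longleftrightarrow> ?thesis"
  proof (intro uniform_limit_cong)
    fix z :: complex assume z: "z \<in> cball 0 R"
    have "(\<lambda>N. \<Prod>n<N. factor n z) \<longlonglongrightarrow> g z"
      using tendsto_uniform_limitI[OF g z] .
    moreover have "(\<lambda>N. \<Prod>n<N. factor n z) \<longlonglongrightarrow> P z"
      using has_prod_imp_tendsto'[OF has_prod_factor[of z]] z assms by simp
    ultimately show "g z = P z" by (rule LIMSEQ_unique)
  qed auto
  finally show ?thesis .
qed

lemma holomorphic: "P holomorphic_on ball 0 1"
proof (rule holomorphic_uniform_sequence)
  show "(\<lambda>z. \<Prod>n<N. factor n z) holomorphic_on ball 0 1" for N
    by (intro holomorphic_intros factor_holomorphic)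
  fix z :: complex assume "z \<in> ball 0 1"
  define d where "d = (1 - norm z) / 2"
  have d: "d > 0" "norm z + d < 1" using \<open>z \<in> ball 0 1\<close> by (auto simp: d_def field_simps)
  have sub: "cball z d \<subseteq> cball 0 (norm z + d)"
    by (auto simp: dist_norm cball_subset_cball_iff)
  have "uniform_limit (cball z d) (\<lambda>N z. \<Prod>n<N. factor n z) P sequentially"
    by (rule uniform_limit_on_subset[OF uniform_limit_partial_products[OF d(2)] sub])
  moreover have "cball z d \<subseteq> ball 0 1"
    using sub d by force
  ultimately show "\<exists>d>0. cball z d \<subseteq> ball 0 1 \<and>
      uniform_limit (cball z d) (\<lambda>N z. \<Prod>n<N. factor n z) P sequentially"
    using d(1) by blast
qed auto

lemma eq_0_iff:
  assumes "norm z < 1"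
  shows "P z = 0 \<longleftrightarrow> (\<exists>n\<in>I. a n = z)"
proof -
  have "P z = 0 \<longleftrightarrow> (\<exists>n. factor n z = 0)"
    using has_prod_eq_0_iff[OF has_prod_factor[OF assms]] by force
  thus ?thesis
    using blaschke_factor_eq_0_iff[of _ z] norm_less_1 assms by (auto simp: factor_def split: if_splits)
qed

lemma subsequence: "J \<subseteq> I \<Longrightarrow> blaschke_sequence J a"
  by unfold_locales (use norm_less_1 summable summable_on_subset_banach in blast)+

text \<open>Removing finitely many zeros leaves a Blaschke product again. Choosing \<open>F\<close>
  well makes this remainder zero-free where it matters.\<close>

lemma split_finite:
  assumes "finite F" "F \<subseteq> I" "norm z < 1"
  shows "P z = (\<Prod>n\<in>F. blaschke_factor (a n) z) * blaschke_sequence.P (I - F) a z"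
proof -
  interpret G: blaschke_sequence "I - F" a by (rule subsequence) auto
  have "(\<lambda>n. (if n \<in> F then blaschke_factor (a n) z else 1) * G.factor n z) has_prod
          ((\<Prod>n\<in>F. if n \<in> F then blaschke_factor (a n) z else 1) * G.P z)"
    by (intro has_prod_mult G.has_prod_factor has_prod_finite) (use assms in auto)
  also have "(\<lambda>n. (if n \<in> F then blaschke_factor (a n) z else 1) * G.factor n z) = (\<lambda>n. factor n z)"
    using assms by (intro ext) (auto simp: factor_def G.factor_def)
  finally show ?thesis
    using has_prod_unique2 has_prod_factor[OF assms(3)] by simp
qed

section \<open>Multiplicities of the zeros\<close>

lemma finite_occs:
  assumes "norm z < 1"
  shows "finite {n\<in>I. a n = z}"
  by (rule finite_subset[OF _ finite_norm_le[OF assms]]) auto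

text \<open>The factors vanishing at \<open>z\<close> are split off. Each has a simple zero there,
  and the remainder is analytic and nonzero at \<open>z\<close>; orders add up.\<close>

lemma zorder_eq_card:
  assumes "norm z < 1"
  shows "zorder P z = card {n\<in>I. a n = z}"
proof -
  define F where "F = {n\<in>I. a n = z}"
  have F: "finite F" "F \<subseteq> I" using finite_occs[OF assms] by (auto simp: F_def)
  interpret G: blaschke_sequence "I - F" a by (rule subsequence) auto
  define h where "h w = (\<Prod>n\<in>F. blaschke_factor (a n) w)" for w
  have G_ana: "G.P analytic_on {z}"
    using G.holomorphic assms by (auto simp: analytic_on_open[symmetric] intro: analytic_on_subset)
  have h_ana: "h analytic_on {z}"
    unfolding h_def[abs_def]
    by (intro analytic_intros blaschke_factor_analytic) (use F norm_less_1 assms in auto)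
  have G_nz: "G.P z \<noteq> 0"
    using G.eq_0_iff[OF assms] by (auto simp: F_def)
  have in_ball: "eventually (\<lambda>w. w \<in> ball 0 1) (at z)"
    using eventually_at_in_open'[of "ball 0 1" z] assms by simp
  have h_nz: "eventually (\<lambda>w. h w \<noteq> 0) (at z)"
    using in_ball eventually_neq_at_within[of z]
    by eventually_elim (use F norm_less_1 in \<open>auto simp: h_def F_def blaschke_factor_eq_0_iff\<close>)
  have G_ev: "eventually (\<lambda>w. G.P w \<noteq> 0) (at z)"
    using analytic_at_imp_isCont[OF G_ana] G_nz
    by (auto simp: isCont_def intro!: tendsto_imp_eventually_ne)
  have "zorder P z = zorder (\<lambda>w. h w * G.P w) z"
    by (rule zorder_cong[OF eventually_mono[OF in_ball] refl])
       (use split_finite[OF F] in \<open>auto simp: h_def\<close>)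
  also have "\<dots> = zorder h z + zorder G.P z"
    by (rule zorder_times_analytic[OF h_ana G_ana])
       (use h_nz G_ev in \<open>eventually_elim; auto\<close>)
  also have "zorder G.P z = 0"
    by (rule zorder_eq_0I[OF G_ana G_nz])
  also have "zorder h z = (\<Sum>n\<in>F. zorder (blaschke_factor (a n)) z)"
    using h_nz unfolding h_def[abs_def]
    by (intro zorder_prod_analytic blaschke_factor_analytic) (use F norm_less_1 assms in auto)
  also have "\<dots> = (\<Sum>n\<in>F. 1)"
    by (intro sum.cong refl) (use zorder_blaschke_factor norm_less_1 in \<open>auto simp: F_def\<close>)
  finally show ?thesis by (simp add: F_def)
qed

section \<open>Jensen's formula for Blaschke products\<close>

text \<open>With no zeros in the disc of radius \<open>R > r\<close>, the mean is
  \<open>ln (norm (P 0))\<close>, and at the origin a factor has modulus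
  \<open>norm (a n)\<close>.\<close>

lemma has_circle_mean_ln_nonvanishing:
  assumes "0 < r" "r < R" "R \<le> 1" "\<And>n. n \<in> I \<Longrightarrow> norm (a n) \<ge> R"
  obtains m where "has_circle_mean (\<lambda>z. ln (norm (P z))) r m" "((\<lambda>n. ln (norm (a n))) has_sum m) I"
proof
  have nz: "P z \<noteq> 0" if "norm z < R" for z
    using eq_0_iff[of z] that assms(3,4) by force
  show "has_circle_mean (\<lambda>z. ln (norm (P z))) r (ln (norm (P 0)))"
    by (rule has_circle_mean_ln_norm_holomorphic[where R = R])
       (use assms nz in \<open>auto intro!: holomorphic_on_subset[OF holomorphic]\<close>)
  have "(\<lambda>n. norm (factor n 0)) has_prod norm (P 0)"
    by (intro has_prod_norm has_prod_factor) auto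
  moreover have pos: "norm (factor n 0) > 0" for n
    using assms(1,2) assms(4)[of n] norm_less_1[of n]
    by (auto simp: factor_def blaschke_factor_eq_0_iff)
  ultimately have "(\<lambda>n. ln (norm (factor n 0))) sums ln (norm (P 0))"
    by (rule has_prod_imp_sums_ln_real')
  \<comment> \<open>The sign is changed because a convergent series of nonnegative terms is summable
    in any order.\<close>
  hence "(\<lambda>n. - ln (norm (factor n 0))) sums (- ln (norm (P 0)))"
    by (rule sums_minus)
  moreover have fac: "norm (factor n 0) = (if n \<in> I then norm (a n) else 1)" for n
    by (simp add: factor_def norm_blaschke_factor)
  hence "- ln (norm (factor n 0)) \<ge> 0" for n
    using pos[of n] norm_less_1[of n] by auto
  ultimately have "((\<lambda>n. - ln (norm (factor n 0))) has_sum (- ln (norm (P 0)))) UNIV"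
    by (rule sums_nonneg_imp_has_sum)
  hence "((\<lambda>n. ln (norm (factor n 0))) has_sum ln (norm (P 0))) UNIV"
    by (simp add: has_sum_uminus)
  also have "?this \<longleftrightarrow> ((\<lambda>n. ln (norm (a n))) has_sum ln (norm (P 0))) I"
    by (rule has_sum_cong_neutral) (auto simp: fac)
  finally show "((\<lambda>n. ln (norm (a n))) has_sum ln (norm (P 0))) I" .
qed

text \<open>The finitely many zeros of modulus at most \<open>R\<close> are treated factor by
  factor. The remaining product is zero-free on the disc of radius \<open>R > r\<close>, and for its
  zeros the maximum is \<open>norm (a n)\<close>.\<close>

lemma has_circle_mean_ln_norm:
  assumes "0 < r" "r < 1"
  obtains m where "has_circle_mean (\<lambda>z. ln (norm (P z))) r m"
    "((\<lambda>n. ln (max (norm (a n)) r)) has_sum m) I"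
proof -
  define R where "R = (1 + r) / 2"
  have R: "r < R" "R < 1" using assms by (auto simp: R_def)
  define F where "F = {n\<in>I. norm (a n) \<le> R}"
  have F: "finite F" "F \<subseteq> I" using finite_norm_le[OF R(2)] by (auto simp: F_def)
  interpret G: blaschke_sequence "I - F" a by (rule subsequence) auto
  obtain m where m: "has_circle_mean (\<lambda>z. ln (norm (G.P z))) r m"
      "((\<lambda>n. ln (norm (a n))) has_sum m) (I - F)"
    using G.has_circle_mean_ln_nonvanishing[of r R] assms R by (force simp: F_def)
  let ?s = "\<Sum>n\<in>F. ln (max (norm (a n)) r)"
  have "has_circle_mean (\<lambda>z. (\<Sum>n\<in>F. ln (norm (blaschke_factor (a n) z))) + ln (norm (G.P z))) r (?s + m)"
    by (intro has_circle_mean_add has_circle_mean_sum has_circle_mean_ln_blaschke_factor m)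
       (use F norm_less_1 assms in auto)
  hence "has_circle_mean (\<lambda>z. ln (norm (P z))) r (?s + m)"
  \<comment> \<open>Off the countable set of zeros no factor vanishes, so the logarithm of the
    product splits.\<close>
  proof (rule has_circle_mean_cong[where A = "a ` I"])
    fix z :: complex assume z: "norm z = r" "z \<notin> a ` I"
    have "P z \<noteq> 0" using z eq_0_iff[of z] assms by auto
    hence "(\<Prod>n\<in>F. blaschke_factor (a n) z) \<noteq> 0" "G.P z \<noteq> 0"
      using split_finite[OF F, of z] z assms by auto
    moreover from this(1) have "ln (\<Prod>n\<in>F. norm (blaschke_factor (a n) z)) =
        (\<Sum>n\<in>F. ln (norm (blaschke_factor (a n) z)))"
      using F by (intro ln_prod) auto
    ultimately show "(\<Sum>n\<in>F. ln (norm (blaschke_factor (a n) z))) + ln (norm (G.P z)) = ln (norm (P z))"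
      using split_finite[OF F, of z] z assms
      by (simp add: norm_mult prod_norm ln_mult)
  qed (use assms in auto)
  moreover have "((\<lambda>n. ln (max (norm (a n)) r)) has_sum (?s + m)) (F \<union> (I - F))"
  proof (rule has_sum_Un_disjoint)
    show "((\<lambda>n. ln (max (norm (a n)) r)) has_sum m) (I - F)"
      using m(2) by (rule has_sum_cong[THEN iffD1, rotated]) (use R in \<open>auto simp: F_def max_def\<close>)
  qed (use F in auto)
  moreover have "F \<union> (I - F) = I" using F by auto
  ultimately show ?thesis using that by metis
qed

end

subsection \<open>Jensen weights and dyadic levels\<close>

text \<open>Contribution of one zero of modulus \<open>\<rho>\<close> to \<open>T r\<close> in
  Jensen's formula. For \<open>r > 0\<close> the maximum keeps the logarithm away from
  \<open>ln 0\<close>, even for a zero at the origin.\<close>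

definition jensen_weight :: "real \<Rightarrow> real \<Rightarrow> real" where
  "jensen_weight r \<rho> = ln (max \<rho> r) / ln r"

lemma jensen_weight_eq_1: "0 < r \<Longrightarrow> r < 1 \<Longrightarrow> \<rho> \<le> r \<Longrightarrow> jensen_weight r \<rho> = 1"
  by (simp add: jensen_weight_def max_def)

lemma jensen_weight_outside: "r \<le> \<rho> \<Longrightarrow> jensen_weight r \<rho> = ln \<rho> / ln r"
  by (auto simp: jensen_weight_def max_def)

lemma jensen_weight_nonneg:
  assumes "0 < r" "r < 1" "\<rho> < 1"
  shows "0 \<le> jensen_weight r \<rho>"
  unfolding jensen_weight_def
  by (rule divide_nonpos_nonpos) (use assms in auto)

lemma jensen_weight_le_1:
  assumes "0 < r" "r < 1"
  shows "jensen_weight r \<rho> \<le> 1"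
proof -
  have "ln r \<le> ln (max \<rho> r)" using assms by (subst ln_le_cancel_iff) auto
  thus ?thesis using assms by (simp add: jensen_weight_def divide_le_eq_1)
qed

text \<open>For \<open>\<rho> \<le> s\<close> the weight at \<open>s\<close> has its maximal value
  1. Otherwise the negative numerator \<open>ln \<rho>\<close> is the same at both radii, and only
  the negative denominator moves towards 0.\<close>

lemma jensen_weight_mono:
  assumes "0 < r" "r \<le> s" "s < 1" "\<rho> < 1"
  shows "jensen_weight r \<rho> \<le> jensen_weight s \<rho>"
proof (cases "\<rho> \<le> s")
  case True
  thus ?thesis using assms jensen_weight_le_1[of r \<rho>] by (simp add: jensen_weight_eq_1)
next
  case False
  have "ln r \<le> ln s" "ln s < 0" "ln \<rho> < 0" using assms False by auto
  hence "ln \<rho> / ln r \<le> ln \<rho> / ln s"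
    by (intro divide_left_mono_neg) (auto intro: mult_neg_neg)
  thus ?thesis using assms False by (simp add: jensen_weight_outside)
qed

text \<open>Together with \<open>neg_ln_le\<close>, this compares \<open>- ln (1 - x)\<close> with
  \<open>x\<close> up to a factor 2 for \<open>0 \<le> x \<le> 1/2\<close>.\<close>

lemma neg_ln_ge:
  fixes x :: real
  assumes "x < 1"
  shows "x \<le> - ln (1 - x)"
  using ln_le_minus_one[of "1 - x"] assms by simp

lemma neg_ln_le:
  fixes x :: real
  assumes "0 \<le> x" "x \<le> 1/2"
  shows "- ln (1 - x) \<le> 2 * x"
proof -
  have "- ln (1 - x) = ln (1 / (1 - x))" using assms by (simp add: ln_div)
  also have "\<dots> \<le> 1 / (1 - x) - 1" using assms by (intro ln_le_minus_one) auto
  also have "\<dots> = x / (1 - x)" using assms by (simp add: field_simps)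
  also have "\<dots> \<le> x / (1/2)" using assms by (intro divide_left_mono) auto
  finally show ?thesis by simp
qed

lemma jensen_weight_upper:
  assumes "0 < y" "y < x" "x \<le> 1/2"
  shows "jensen_weight (1 - x) (1 - y) \<le> 2 * y / x"
proof -
  have "jensen_weight (1 - x) (1 - y) = (- ln (1 - y)) / (- ln (1 - x))"
    using assms by (simp add: jensen_weight_outside)
  also have "\<dots> \<le> (2 * y) / x"
    using assms neg_ln_le[of y] neg_ln_ge[of x] by (intro frac_le) auto
  finally show ?thesis .
qed

text \<open>As \<open>(1 - x)\<^sup>2 \<ge> 1 - 2 x\<close>, the denominator of the weight at least doubles from \<open>1 - x\<close> to \<open>1 - 2 x\<close>.\<close>
lemma jensen_weight_jump:
  assumes "x / 2 \<le> y" "y \<le> x" "0 < x" "x \<le> 1/4"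
  shows "1 / 8 \<le> jensen_weight (1 - x) (1 - y) - jensen_weight (1 - 2 * x) (1 - y)"
proof -
  define L where "L = - ln (1 - x)"
  have L: "0 < L" "L \<le> 2 * x"
    using neg_ln_ge[of x] neg_ln_le[of x] assms by (auto simp: L_def)
  have "1 - 2 * x \<le> (1 - x)\<^sup>2" by (simp add: power2_eq_square algebra_simps)
  moreover have "0 < (1 - x)\<^sup>2" using assms by simp
  ultimately have "ln (1 - 2 * x) \<le> ln ((1 - x)\<^sup>2)"
    using assms by (subst ln_le_cancel_iff) auto
  also have "\<dots> = - 2 * L" using assms by (simp add: L_def ln_realpow)
  finally have L2: "2 * L \<le> - ln (1 - 2 * x)" by simp
  define l where "l = - ln (1 - y)"
  have l: "x / 2 \<le> l" using neg_ln_ge[of y] assms by (simp add: l_def)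
  \<comment> \<open>The extreme case of \<open>l \<ge> x / 2\<close> and
    \<open>L \<le> 2 * x\<close>.\<close>
  have "1 / 8 = (x / 2) / (2 * (2 * x))" using assms by simp
  also have "\<dots> \<le> l / (2 * L)"
    using l L assms by (intro frac_le) auto
  \<comment> \<open>Doubling the denominator halves the weight, so at least half of
    \<open>l / L\<close> is gained.\<close>
  also have "\<dots> = l / L - l / (2 * L)" using L by (simp add: field_simps)
  also have "\<dots> \<le> l / L - l / (- ln (1 - 2 * x))"
    using L2 L l assms by (intro diff_left_mono divide_left_mono mult_pos_pos) auto
  also have "l / L = jensen_weight (1 - x) (1 - y)"
    using assms by (simp add: jensen_weight_outside l_def L_def)
  also have "l / (- ln (1 - 2 * x)) = jensen_weight (1 - 2 * x) (1 - y)"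
    using assms by (simp add: jensen_weight_outside l_def)
  finally show ?thesis .
qed

text \<open>The least \<open>k \<ge> N\<close> with \<open>(1/2) ^ (k + 1) \<le> x\<close> works:
  minimality gives the upper bound, except for \<open>k = N\<close>, where it is assumed.\<close>

lemma dyadic_level_exists:
  fixes x :: real
  assumes "0 < x" "x \<le> (1/2) ^ N"
  obtains k where "N \<le> k" "(1/2) ^ (k + 1) \<le> x" "x \<le> (1/2) ^ k"
proof -
  define k where "k = (LEAST k. (1/2) ^ (k + 1) \<le> x \<and> N \<le> k)"
  obtain j where "(1/2) ^ j < x" using real_arch_pow_inv[of x "1/2"] assms by auto
  moreover have "(1/2::real) ^ (max j N + 1) \<le> (1/2) ^ j" by (intro power_decreasing) auto
  ultimately have "(1/2) ^ (max j N + 1) \<le> x \<and> N \<le> max j N" by simp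
  hence k: "(1/2) ^ (k + 1) \<le> x \<and> N \<le> k"
    unfolding k_def by (rule LeastI)
  have "x \<le> (1/2) ^ k"
  proof (cases "k = N")
    case False
    with k have "k - 1 < k" "N \<le> k - 1" "k - 1 + 1 = k" by auto
    thus ?thesis
      using not_less_Least[of "k - 1" "\<lambda>k. (1/2) ^ (k + 1) \<le> x \<and> N \<le> k"] k_def by force
  qed (use assms in auto)
  with k that show ?thesis by blast
qed

lemma sum_half_powers_le:
  assumes "finite A" "A \<subseteq> {N..}"
  shows "(\<Sum>k\<in>A. (1/2::real) ^ k) \<le> 2 * (1/2) ^ N"
proof -
  obtain K where K: "A \<subseteq> {..K}" using assms(1) finite_nat_iff_bounded_le by blast
  \<comment> \<open>The upper end \<open>N + K\<close> keeps the interval nonempty, so the closed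
    form can be proved by induction on \<open>K\<close>.\<close>
  have "(\<Sum>k\<in>A. (1/2::real) ^ k) \<le> (\<Sum>k\<in>{N..N+K}. (1/2) ^ k)"
    using assms K by (intro sum_mono2) force+
  also have "\<dots> = 2 * (1/2) ^ N - (1/2) ^ (N + K)"
  proof (induction K)
    case (Suc K)
    have "(\<Sum>k\<in>{N..N+Suc K}. (1/2::real) ^ k) = (\<Sum>k\<in>{N..N+K}. (1/2) ^ k) + (1/2) ^ (N + Suc K)"
      by simp
    thus ?case unfolding Suc.IH by simp
  qed auto
  also have "\<dots> \<le> 2 * (1/2) ^ N" by simp
  finally show ?thesis .
qed

section \<open>Level counts and increments of \<open>T\<close>\<close>

context blaschke_sequence
begin

text \<open>A set of indices, not of points, so that its cardinality counts multiplicity.\<close>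

definition level :: "nat \<Rightarrow> nat set" where
  "level k = {n\<in>I. (1/2) ^ (k + 1) \<le> 1 - norm (a n) \<and> 1 - norm (a n) \<le> (1/2) ^ k}"

lemma finite_level: "finite (level k)"
  by (rule finite_subset[OF _ finite_norm_le[of "1 - (1/2) ^ (k + 1)"]]) (auto simp: level_def)

text \<open>Grouping the indices of a level by the zero they name, each group has the order of that
  zero as its size. The order is local, so agreement with \<open>P\<close> on the disc is
  enough.\<close>

lemma dyadic_zero_count_eq:
  assumes B: "\<And>z. norm z < 1 \<Longrightarrow> B z = P z"
  shows "dyadic_zero_count B k = int (card (level k))"
proof -
  \<comment> \<open>Zeros that \<open>B\<close> may have outside the disc are excluded by the lower
    bound on \<open>1 - norm z\<close>.\<close>
  have lt: "norm z < 1" if "(1/2) ^ (k + 1) \<le> 1 - norm z" for z :: complex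
    using that zero_less_power[of "1/2::real" "k + 1"] by linarith
  define Z where "Z = {z. B z = 0 \<and> (1/2) ^ (k + 1) \<le> 1 - norm z \<and> 1 - norm z \<le> (1/2) ^ k}"
  have Z: "Z = a ` level k"
    unfolding Z_def level_def using lt B eq_0_iff by (auto simp: image_iff)
  have "dyadic_zero_count B k = (\<Sum>z\<in>Z. int (card {n\<in>level k. a n = z}))"
    unfolding dyadic_zero_count_def Z_def[symmetric]
  proof (rule sum.cong)
    fix z assume z: "z \<in> Z"
    hence z1: "norm z < 1" using lt by (auto simp: Z_def)
    have "eventually (\<lambda>w. w \<in> ball 0 1) (at z)"
      using eventually_at_in_open'[of "ball 0 1" z] z1 by simp
    hence "zorder B z = zorder P z"
      by (intro zorder_cong refl) (auto elim!: eventually_mono simp: B)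
    also have "\<dots> = card {n\<in>I. a n = z}" by (rule zorder_eq_card[OF z1])
    also have "{n\<in>I. a n = z} = {n\<in>level k. a n = z}" using z by (auto simp: Z_def level_def)
    finally show "zorder B z = int (card {n\<in>level k. a n = z})" .
  qed auto
  also have "\<dots> = int (\<Sum>z\<in>Z. \<Sum>n | n \<in> level k \<and> a n = z. 1)" by simp
  also have "(\<Sum>z\<in>Z. \<Sum>n | n \<in> level k \<and> a n = z. 1) = (\<Sum>n\<in>level k. 1)"
    by (rule sum.group) (use Z finite_level in auto)
  finally show ?thesis by simp
qed

lemma blaschke_T_has_sum:
  assumes B: "\<And>z. norm z < 1 \<Longrightarrow> B z = P z" and "0 < r" "r < 1"
  shows "((\<lambda>n. jensen_weight r (norm (a n))) has_sum blaschke_T B r) I"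
proof -
  obtain m where m: "has_circle_mean (\<lambda>z. ln (norm (P z))) r m"
      "((\<lambda>n. ln (max (norm (a n)) r)) has_sum m) I"
    using has_circle_mean_ln_norm assms(2,3) by blast
  have "has_circle_mean (\<lambda>z. ln (norm (B z))) r m"
    by (rule has_circle_mean_cong[OF m(1), where A = "{}"]) (use B assms in auto)
  from has_circle_mean_imp_LBINT[OF this] have "blaschke_T B r = m * (1 / ln r)"
    by (simp add: blaschke_T_def)
  thus ?thesis
    using has_sum_cmult_left[OF m(2), of "1 / ln r"] by (simp add: jensen_weight_def)
qed

lemma blaschke_T_diff_has_sum:
  assumes "\<And>z. norm z < 1 \<Longrightarrow> B z = P z" and "0 < r" "r < 1" "0 < s" "s < 1"
  shows "((\<lambda>n. jensen_weight s (norm (a n)) - jensen_weight r (norm (a n))) has_sum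
           (blaschke_T B s - blaschke_T B r)) I"
proof -
  have "((\<lambda>n. jensen_weight s (norm (a n))) has_sum blaschke_T B s) I"
    "((\<lambda>n. jensen_weight r (norm (a n))) has_sum blaschke_T B r) I"
    by (rule blaschke_T_has_sum; use assms in simp)+
  from has_sum_add[OF this(1) has_sum_uminusI[OF this(2)]] show ?thesis by simp
qed

text \<open>Each zero of level \<open>N + 1\<close> gains at least \<open>1/8\<close> and no weight
  decreases, so the finite sum over the level stays below the total increment.\<close>

lemma card_level_le:
  assumes B: "\<And>z. norm z < 1 \<Longrightarrow> B z = P z" and "N \<ge> 1"
  shows "real (card (level (N + 1))) \<le>
           8 * \<bar>blaschke_T B (1 - (1/2) ^ (N + 1)) - blaschke_T B (1 - (1/2) ^ N)\<bar>"
proof -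
  define x :: real where "x = (1/2) ^ (N + 1)"
  \<comment> \<open>\<open>N \<ge> 1\<close> enters here: it gives the bound
    \<open>x \<le> 1/4\<close> required by \<open>jensen_weight_jump\<close>.\<close>
  have "x \<le> (1/2) ^ 2" unfolding x_def using assms by (intro power_decreasing) auto
  hence x: "0 < x" "x \<le> 1/4" by (auto simp: x_def power2_eq_square)
  have x2: "(1/2) ^ N = 2 * x" by (simp add: x_def)
  define d where "d n = jensen_weight (1 - x) (norm (a n)) - jensen_weight (1 - 2 * x) (norm (a n))" for n
  have d: "(d has_sum (blaschke_T B (1 - x) - blaschke_T B (1 - 2 * x))) I"
    unfolding d_def[abs_def] by (rule blaschke_T_diff_has_sum) (use B x in auto)
  have "real (card (level (N + 1))) / 8 = (\<Sum>n\<in>level (N + 1). 1 / 8)" by simp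
  also have "\<dots> \<le> (\<Sum>n\<in>level (N + 1). d n)"
  proof (rule sum_mono)
    fix n assume "n \<in> level (N + 1)"
    hence "x / 2 \<le> 1 - norm (a n)" "1 - norm (a n) \<le> x" by (auto simp: level_def x_def)
    from jensen_weight_jump[OF this x] show "1 / 8 \<le> d n" by (simp add: d_def)
  qed
  also have "\<dots> \<le> blaschke_T B (1 - x) - blaschke_T B (1 - 2 * x)"
  proof (rule finite_sum_le_has_sum[OF d finite_level])
    show "0 \<le> d n" if "n \<in> I - level (N + 1)" for n
      using jensen_weight_mono[of "1 - 2 * x" "1 - x" "norm (a n)"] that norm_less_1 x by (auto simp: d_def)
  qed (auto simp: level_def)
  also have "\<dots> \<le> \<bar>blaschke_T B (1 - x) - blaschke_T B (1 - 2 * x)\<bar>" by (rule abs_ge_self)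
  finally show ?thesis unfolding x2 x_def[symmetric] by simp
qed

text \<open>A zero at level \<open>k \<ge> N\<close> gains at most \<open>2 * (1/2) ^ k / x\<close>,
  each level has at most \<open>M\<close> zeros, and the powers sum to at most
  \<open>2 * (1/2) ^ N = 4 * x\<close>; hence \<open>8 * M\<close>.\<close>

lemma blaschke_T_jump_le:
  assumes B: "\<And>z. norm z < 1 \<Longrightarrow> B z = P z" and "N \<ge> 1"
    and M: "\<And>k. k \<ge> 1 \<Longrightarrow> real (card (level k)) \<le> M"
  shows "\<bar>blaschke_T B (1 - (1/2) ^ (N + 1)) - blaschke_T B (1 - (1/2) ^ N)\<bar> \<le> 8 * M"
proof -
  define x :: real where "x = (1/2) ^ (N + 1)"
  have "x \<le> (1/2) ^ 2" unfolding x_def using assms by (intro power_decreasing) auto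
  hence x: "0 < x" "x \<le> 1/4" by (auto simp: x_def power2_eq_square)
  have x2: "(1/2) ^ N = 2 * x" by (simp add: x_def)
  define d where "d n = jensen_weight (1 - x) (norm (a n)) - jensen_weight (1 - 2 * x) (norm (a n))" for n
  have d: "(d has_sum (blaschke_T B (1 - x) - blaschke_T B (1 - 2 * x))) I"
    unfolding d_def[abs_def] by (rule blaschke_T_diff_has_sum) (use B x in auto)
  have d_nonneg: "0 \<le> d n" if "n \<in> I" for n
    using jensen_weight_mono[of "1 - 2 * x" "1 - x" "norm (a n)"] norm_less_1[OF that] x by (auto simp: d_def)
  have d_zero: "d n = 0" if "norm (a n) \<le> 1 - 2 * x" for n
    using that x by (simp add: d_def jensen_weight_eq_1)
  have d_level: "d n \<le> 2 * (1/2) ^ k / x" if n: "n \<in> level k" and "k \<ge> N" for n k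
  proof -
    have y: "0 < 1 - norm (a n)" "1 - norm (a n) \<le> (1/2) ^ k"
      using n norm_less_1 by (auto simp: level_def)
    have dw: "d n \<le> jensen_weight (1 - x) (norm (a n))"
      using jensen_weight_nonneg[of "1 - 2 * x" "norm (a n)"] x y by (simp add: d_def)
    show ?thesis
    proof (cases "1 - norm (a n) < x")
      case True
      have "jensen_weight (1 - x) (1 - (1 - norm (a n))) \<le> 2 * (1 - norm (a n)) / x"
        by (rule jensen_weight_upper) (use True x y in auto)
      also have "\<dots> \<le> 2 * (1/2) ^ k / x" using x y by (intro divide_right_mono) auto
      finally show ?thesis using dw by simp
    next
      \<comment> \<open>Too far from the unit circle for \<open>jensen_weight_upper\<close>, but
        then \<open>x \<le> (1/2) ^ k\<close> makes the claimed bound exceed the maximal weight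
        1.\<close>
      case False
      hence "x \<le> (1/2) ^ k" using y by linarith
      hence "1 \<le> 2 * (1/2) ^ k / x" using x by (simp add: field_simps)
      thus ?thesis using dw jensen_weight_le_1[of "1 - x" "norm (a n)"] x by linarith
    qed
  qed
  have "\<exists>k. N \<le> k \<and> n \<in> level k" if "n \<in> I" "1 - 2 * x < norm (a n)" for n
    using dyadic_level_exists[of "1 - norm (a n)" N] that norm_less_1[of n] x2
    by (auto simp: level_def)
  \<comment> \<open>The closed levels overlap at their end points; \<open>\<kappa>\<close> selects
    one level per zero, so that its fibres partition \<open>F'\<close>.\<close>
  then obtain \<kappa> where \<kappa>: "\<And>n. n \<in> I \<Longrightarrow> 1 - 2 * x < norm (a n) \<Longrightarrow> N \<le> \<kappa> n \<and> n \<in> level (\<kappa> n)"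
    by metis
  have "0 \<le> M" using M[of 1] by (meson of_nat_0_le_iff order_trans order_refl)
  have "blaschke_T B (1 - x) - blaschke_T B (1 - 2 * x) \<le> 8 * M"
  proof (rule has_sum_le_finite_sums[OF d])
    fix F assume F: "finite F" "F \<subseteq> I"
    define F' where "F' = {n\<in>F. 1 - 2 * x < norm (a n)}"
    have F': "finite F'" "F' \<subseteq> I" using F by (auto simp: F'_def)
    have "sum d F = sum d F'"
      using F d_zero by (intro sum.mono_neutral_right) (auto simp: F'_def not_less)
    also have "\<dots> = (\<Sum>k\<in>\<kappa> ` F'. \<Sum>n | n \<in> F' \<and> \<kappa> n = k. d n)"
      by (rule sum.group[symmetric]) (use F' in auto)
    also have "\<dots> \<le> (\<Sum>k\<in>\<kappa> ` F'. M * (2 * (1/2) ^ k / x))"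
    proof (rule sum_mono)
      fix k assume "k \<in> \<kappa> ` F'"
      hence kN: "N \<le> k" using \<kappa> F' by (auto simp: F'_def)
      have sub: "{n. n \<in> F' \<and> \<kappa> n = k} \<subseteq> level k"
        using \<kappa> F' by (auto simp: F'_def)
      have "(\<Sum>n | n \<in> F' \<and> \<kappa> n = k. d n) \<le> (\<Sum>n\<in>level k. d n)"
        using sub d_nonneg by (intro sum_mono2 finite_level) (auto simp: level_def)
      also have "\<dots> \<le> (\<Sum>n\<in>level k. 2 * (1/2) ^ k / x)"
        using d_level kN by (intro sum_mono) auto
      also have "\<dots> = real (card (level k)) * (2 * (1/2) ^ k / x)" by simp
      also have "\<dots> \<le> M * (2 * (1/2) ^ k / x)"
        using M[of k] kN assms(2) x by (intro mult_right_mono) auto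
      finally show "(\<Sum>n | n \<in> F' \<and> \<kappa> n = k. d n) \<le> M * (2 * (1/2) ^ k / x)" .
    qed
    also have "\<dots> = 2 * M / x * (\<Sum>k\<in>\<kappa> ` F'. (1/2) ^ k)"
      by (simp add: sum_distrib_left mult_ac)
    also have "\<dots> \<le> 2 * M / x * (2 * (1/2) ^ N)"
      using \<kappa> F' \<open>0 \<le> M\<close> x by (intro mult_left_mono sum_half_powers_le) (auto simp: F'_def)
    also have "\<dots> = 8 * M" unfolding x2 using x by simp
    finally show "sum d F \<le> 8 * M" .
  qed
  moreover have "0 \<le> blaschke_T B (1 - x) - blaschke_T B (1 - 2 * x)"
    using has_sum_nonneg[OF d] d_nonneg by blast
  ultimately show ?thesis unfolding x2 x_def[symmetric] by linarith
qed

end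

theorem theorem2:
  fixes B :: "complex \<Rightarrow> complex"
  assumes "is_blaschke_product B"
  shows "exponential_blaschke_product B \<longleftrightarrow>
    (\<exists>M::real. M > 0 \<and>
      (\<forall>N::nat. N \<ge> 1 \<longrightarrow>
        \<bar>blaschke_T B (1 - (1/2) ^ (N + 1)) - blaschke_T B (1 - (1/2) ^ N)\<bar> \<le> M))"
proof -
  obtain I a where Ia: "\<forall>n\<in>I. norm (a n) < 1" "(\<lambda>n. 1 - norm (a n)) summable_on I"
    "\<And>z. norm z < 1 \<Longrightarrow> B z = (\<Prod>n. if n \<in> I then blaschke_factor (a n) z else 1)"
    using assms unfolding is_blaschke_product_def by blast
  interpret blaschke_sequence I a by unfold_locales (use Ia in auto)
  have B: "B z = P z" if "norm z < 1" for z
    using Ia(3)[OF that] by (simp add: P_def factor_def)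
  have "exponential_blaschke_product B \<longleftrightarrow> (\<exists>M>0. \<forall>k\<ge>1. real (card (level k)) \<le> M)"
    using assms by (simp add: exponential_blaschke_product_def dyadic_zero_count_eq[OF B])
  also have "\<dots> \<longleftrightarrow> (\<exists>M::real. M > 0 \<and> (\<forall>N::nat. N \<ge> 1 \<longrightarrow>
      \<bar>blaschke_T B (1 - (1/2) ^ (N + 1)) - blaschke_T B (1 - (1/2) ^ N)\<bar> \<le> M))"
  proof (intro iffI; elim exE conjE)
    fix M :: real assume "M > 0" and M: "\<forall>k\<ge>1. real (card (level k)) \<le> M"
    have "\<bar>blaschke_T B (1 - (1/2) ^ (N + 1)) - blaschke_T B (1 - (1/2) ^ N)\<bar> \<le> 8 * M"
      if "N \<ge> 1" for N
      by (rule blaschke_T_jump_le) (use B that M in auto)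
    with \<open>M > 0\<close> show "\<exists>M::real. M > 0 \<and> (\<forall>N::nat. N \<ge> 1 \<longrightarrow>
      \<bar>blaschke_T B (1 - (1/2) ^ (N + 1)) - blaschke_T B (1 - (1/2) ^ N)\<bar> \<le> M)"
      by (intro exI[of _ "8 * M"]) auto
  next
    fix M :: real assume "M > 0" and M: "\<forall>N::nat. N \<ge> 1 \<longrightarrow>
      \<bar>blaschke_T B (1 - (1/2) ^ (N + 1)) - blaschke_T B (1 - (1/2) ^ N)\<bar> \<le> M"
    \<comment> \<open>The increments with \<open>N \<ge> 1\<close> control only the levels from 2
      on; level 1 is finite and enters the constant separately.\<close>
    have "real (card (level k)) \<le> max (8 * M) (real (card (level 1)))" if "k \<ge> 1" for k
    proof (cases "k = 1")
      case False
      then obtain N where k: "k = N + 1" and N: "N \<ge> 1" using \<open>k \<ge> 1\<close> by (cases k) auto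
      have "real (card (level (N + 1))) \<le>
          8 * \<bar>blaschke_T B (1 - (1/2) ^ (N + 1)) - blaschke_T B (1 - (1/2) ^ N)\<bar>"
        by (rule card_level_le) (use B N in auto)
      also have "\<dots> \<le> 8 * M" using M[rule_format, OF N] by simp
      finally show ?thesis unfolding k by (rule max.coboundedI1)
    qed auto
    with \<open>M > 0\<close> show "\<exists>M>0. \<forall>k\<ge>1. real (card (level k)) \<le> M"
      by (intro exI[of _ "max (8 * M) (real (card (level 1)))"]) auto
  qed
  finally show ?thesis .
qed

end
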